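(* Let $p$ be an odd prime, $k\ge 1$ an integer, $\alpha\in[0,1]$, and let $G=D_{p^k}$, a group of order $2p^k$. Then the spectrum of $A_\alpha(\mathcal{S}_{D_{p^k}})$, as a multiset of $2p^k$ eigenvalues, consists of: (i) $(p^k+1)\alpha-1$, taken $p^k-1$ times; (ii) $p^k\alpha-1$, taken $p^k-2$ times; (iii) the remaining three eigenvalues, which are the roots $\lambda$ (with multiplicity) of the equation $$\det\begin{pmatrix} (2p^k-1)\alpha-\lambda & (p^k-1)(1-\alpha) & p^k(1-\alpha)\\ 1-\alpha & p^k+\alpha-2-\lambda & 0\\ 1-\alpha & 0 & p^k+\alpha-1-\lambda \end{pmatrix}=0.$$
   Context: $D_n$ denotes the dihedral group of order $2n$, generated by $a,b$ with $o(a)=n$, $o(b)=2$, $ba=a^{-1}b$; $o(x)$ is the order of a group element $x$. For a finite group $G$, the superpower graph $\mathcal{S}_G$ is the simple undirected graph whose vertex set is $G$, with two distinct vertices $x,y$ adjacent if and only if $o(x)\mid o(y)$ or $o(y)\mid o(x)$. For a graph $\Gamma$ with adjacency matrix $A(\Gamma)$ and diagonal matrix of vertex degrees $D(\Gamma)$, and $\alpha\in[0,1]$, the $A_\alpha$-adjacency matrix is $A_\alpha(\Gamma)=\alpha D(\Gamma)+(1-\alpha)A(\Gamma)$. Its spectrum is the multiset of its eigenvalues counted with multiplicity; listed values may coincide for particular parameters, in which case multiplicities add. *)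

theory Defs
  imports
    "HOL-Algebra.Multiplicative_Group"
    "HOL-Algebra.Generated_Groups"
    "Graph_Theory.Pair_Digraph"
    "Jordan_Normal_Form.Char_Poly"
begin

section \<open>Dihedral groups\<close>

text \<open>
  The dihedral group of order \<open>2n\<close>, given by its presentation. The condition on the order
  of \<open>G\<close> is needed to exclude \<open>a = b\<close> when \<open>n = 2\<close>.
\<close>

locale dihedral_group = group G for G (structure) +
  fixes n :: nat and a b
  assumes a_closed: "a \<in> carrier G"
    and b_closed: "b \<in> carrier G"
    and generated: "generate G {a, b} = carrier G"
    and order_G: "Coset.order G = 2 * n"
    and ord_a: "ord a = n"
    and ord_b: "ord b = 2"
    and ba: "b \<otimes> a = inv a \<otimes> b"

text \<open>
  A concrete model, showing that the locale is inhabited for every \<open>n \<ge> 1\<close>: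
  the pair \<open>(i, s)\<close> stands for \<open>a\<^sup>i b\<^sup>s\<close>.
\<close>

definition dihedral_model :: "nat \<Rightarrow> (int \<times> bool) monoid" where
  "dihedral_model n =
     \<lparr> carrier = {0..<int n} \<times> UNIV,
       monoid.mult = (\<lambda>(i, s) (j, t). ((if s then i - j else i + j) mod int n, s \<noteq> t)),
       monoid.one = (0, False) \<rparr>"

lemma dihedral_model_simps:
  "carrier (dihedral_model n) = {0..<int n} \<times> UNIV"
  "(i, s) \<otimes>\<^bsub>dihedral_model n\<^esub> (j, t) = ((if s then i - j else i + j) mod int n, s \<noteq> t)"
  "\<one>\<^bsub>dihedral_model n\<^esub> = (0, False)"
  by (simp_all add: dihedral_model_def)

lemma group_dihedral_model:
  assumes "n \<ge> 1"
  shows "group (dihedral_model n)"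
proof (rule groupI)
  fix x y z
  assume "x \<in> carrier (dihedral_model n)" "y \<in> carrier (dihedral_model n)"
    "z \<in> carrier (dihedral_model n)"
  then show "x \<otimes>\<^bsub>dihedral_model n\<^esub> y \<otimes>\<^bsub>dihedral_model n\<^esub> z =
    x \<otimes>\<^bsub>dihedral_model n\<^esub> (y \<otimes>\<^bsub>dihedral_model n\<^esub> z)"
    by (cases x; cases y; cases z) (auto simp: dihedral_model_simps mod_simps algebra_simps)
next
  fix x
  assume x: "x \<in> carrier (dihedral_model n)"
  obtain i s where xis: "x = (i, s)" by force
  let ?y = "(if s then i else (- i) mod int n, s)"
  have "?y \<in> carrier (dihedral_model n)"
    using x assms by (auto simp: dihedral_model_simps xis)
  moreover have "?y \<otimes>\<^bsub>dihedral_model n\<^esub> x = \<one>\<^bsub>dihedral_model n\<^esub>"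
    by (auto simp: dihedral_model_simps xis mod_simps)
  ultimately show "\<exists>y\<in>carrier (dihedral_model n). y \<otimes>\<^bsub>dihedral_model n\<^esub> x = \<one>\<^bsub>dihedral_model n\<^esub>"
    by blast
qed (use assms in \<open>auto simp: dihedral_model_simps\<close>)

lemma dihedral_group_dihedral_model:
  assumes n: "n \<ge> 1"
  shows "dihedral_group (dihedral_model n) n (1 mod int n, False) (0, True)"
proof -
  let ?D = "dihedral_model n" and ?a = "(1 mod int n, False)" and ?b = "(0 :: int, True)"
  interpret group ?D by (rule group_dihedral_model[OF n])
  have a: "?a \<in> carrier ?D" and b: "?b \<in> carrier ?D"
    using n by (auto simp: dihedral_model_simps)
  have pow_a: "?a [^]\<^bsub>?D\<^esub> m = (int m mod int n, False)" for m :: nat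
    by (induction m) (auto simp: dihedral_model_simps mod_simps algebra_simps)
  have ord_a: "ord ?a = n"
    using ord_unique[OF a, of n] by (auto simp: pow_a dihedral_model_simps mod_eq_0_iff_dvd)
  have pow_b: "?b [^]\<^bsub>?D\<^esub> m = (0, odd m)" for m :: nat
    by (induction m) (auto simp: dihedral_model_simps)
  have ord_b: "ord ?b = 2"
    using ord_unique[OF b, of 2] by (auto simp: pow_b dihedral_model_simps)
  have inv_a: "inv\<^bsub>?D\<^esub> ?a = ((- 1) mod int n, False)"
    by (rule inv_equality) (use n a in \<open>auto simp: dihedral_model_simps mod_simps\<close>)
  have ba: "?b \<otimes>\<^bsub>?D\<^esub> ?a = inv\<^bsub>?D\<^esub> ?a \<otimes>\<^bsub>?D\<^esub> ?b"
    by (auto simp: inv_a dihedral_model_simps mod_simps)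
  have gen_pow: "?a [^]\<^bsub>?D\<^esub> m \<in> generate ?D {?a, ?b}" for m :: nat
    by (induction m) (auto intro: generate.intros)
  have "x \<in> generate ?D {?a, ?b}" if "x \<in> carrier ?D" for x
  proof -
    obtain i s where x: "x = (i, s)" by force
    have i: "0 \<le> i" "i < int n" using that by (auto simp: x dihedral_model_simps)
    have p: "?a [^]\<^bsub>?D\<^esub> nat i = (i, False)" using i by (simp add: pow_a)
    show ?thesis
    proof (cases s)
      case True
      have "x = ?a [^]\<^bsub>?D\<^esub> nat i \<otimes>\<^bsub>?D\<^esub> ?b"
        using i True by (simp add: p x dihedral_model_simps)
      then show ?thesis using gen_pow[of "nat i"] by (auto intro: generate.intros)
    next
      case False
      then show ?thesis using gen_pow[of "nat i"] p x by simp
    qed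
  qed
  then have gen: "generate ?D {?a, ?b} = carrier ?D"
    using generate_incl[of "{?a, ?b}"] a b by blast
  have "Coset.order ?D = 2 * n"
    by (simp add: Coset.order_def dihedral_model_simps card_cartesian_product)
  with a b gen ord_a ord_b ba show ?thesis
    by unfold_locales
qed

section \<open>The superpower graph\<close>

text \<open>Simple undirected graphs are the loop-free symmetric digraphs (\<open>pair_graph\<close>).\<close>

definition superpower_graph :: "('a, 'b) monoid_scheme \<Rightarrow> 'a pair_pre_digraph" where
  "superpower_graph G =
     \<lparr> pverts = carrier G,
       parcs = {(x, y). x \<in> carrier G \<and> y \<in> carrier G \<and> x \<noteq> y \<and>
                  (group.ord G x dvd group.ord G y \<or> group.ord G y dvd group.ord G x)} \<rparr>"

lemma pair_graph_superpower_graph: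
  assumes "finite (carrier G)"
  shows "pair_graph (superpower_graph G)"
proof -
  have "finite (parcs (superpower_graph G))"
    by (rule finite_subset[of _ "carrier G \<times> carrier G"])
      (auto simp: superpower_graph_def assms)
  with assms show ?thesis
    by unfold_locales (auto simp: superpower_graph_def symmetric_def sym_def)
qed

section \<open>The matrix \<open>A\<^sub>\<alpha>\<close> of a graph and its spectrum\<close>

text \<open>
  Rows and columns are indexed by positions in a list \<open>vs\<close> that enumerates the vertices.
  In a symmetric digraph without parallel arcs the out-degree is the degree.
\<close>

definition adjacency_matrix :: "'a pair_pre_digraph \<Rightarrow> 'a list \<Rightarrow> real mat" where
  "adjacency_matrix \<Gamma> vs =
     mat (length vs) (length vs) (\<lambda>(i, j). if (vs ! i, vs ! j) \<in> parcs \<Gamma> then 1 else 0)"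

definition degree_matrix :: "'a pair_pre_digraph \<Rightarrow> 'a list \<Rightarrow> real mat" where
  "degree_matrix \<Gamma> vs =
     mat_diag (length vs) (\<lambda>i. real (out_degree (with_proj \<Gamma>) (vs ! i)))"

definition A_alpha_matrix :: "real \<Rightarrow> 'a pair_pre_digraph \<Rightarrow> 'a list \<Rightarrow> real mat" where
  "A_alpha_matrix \<alpha> \<Gamma> vs =
     \<alpha> \<cdot>\<^sub>m degree_matrix \<Gamma> vs + (1 - \<alpha>) \<cdot>\<^sub>m adjacency_matrix \<Gamma> vs"

text \<open>
  The eigenvalues in the base field, with algebraic multiplicity; over the reals this is
  the whole spectrum iff its size is the dimension of the matrix.
\<close>

definition spectrum_mset :: "'a :: field mat \<Rightarrow> 'a multiset" where
  "spectrum_mset A = proots (char_poly A)"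

end

(* For n = p^k odd, the rotations have odd order and their orders form a chain under divisibility,
   while every element outside the rotation subgroup has order 2. So apart from the diagonal the
   entries of the matrix depend only on the classes {1}, nontrivial rotations and reflections of the
   row and column. For x off finitely many values, the Sylvester identity
   det (D - X Y) = det D * det (1 - Y D^-1 X) reduces det (x - A) to a 3 x 3 determinant, namely that
   of the quotient matrix, up to powers of x - \<delta> for the two repeated eigenvalues. The cubic has
   three real roots because it changes sign at its second and third diagonal entries, unless
   \<alpha> = 1, where it splits trivially. *)
theory Submission imports Defs begin

section \<open>Determinants: order three, and diagonal matrices with a class-constant
  perturbation\<close>

lemma det_3:
  assumes A: "A \<in> carrier_mat 3 3"
  shows "det (A :: 'a :: comm_ring_1 mat) =
    A $$ (0,0) * (A $$ (1,1) * A $$ (2,2) - A $$ (1,2) * A $$ (2,1))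
    - A $$ (0,1) * (A $$ (1,0) * A $$ (2,2) - A $$ (1,2) * A $$ (2,0))
    + A $$ (0,2) * (A $$ (1,0) * A $$ (2,1) - A $$ (1,1) * A $$ (2,0))"
proof -
  have 2: "det (B :: 'a mat) = B $$ (0,0) * B $$ (1,1) - B $$ (0,1) * B $$ (1,0)"
    if B: "B \<in> carrier_mat 2 2" for B
  proof -
    have "det (mat_delete B 0 j) = B $$ (1, 1 - j)" if "j < 2" for j
      using B that by (subst det_single) (auto simp: mat_delete_def)
    then show ?thesis
      using laplace_expansion_row[OF B, of 0] B by (simp add: cofactor_def eval_nat_numeral)
  qed
  show ?thesis
    using laplace_expansion_row[OF A, of 0] A
    by (simp add: cofactor_def 2 mat_delete_def eval_nat_numeral algebra_simps)
qed

lemma det_mat_of_rows_list_3: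
  "det (mat_of_rows_list 3 [[a, b, c], [d, e, f], [g, h, i]]) =
    a * (e * i - f * h) - b * (d * i - f * g) + c * (d * h - e * (g :: 'a :: comm_ring_1))"
proof -
  have "mat_of_rows_list 3 [[a, b, c], [d, e, f], [g, h, i]] \<in> carrier_mat 3 3"
    by (rule carrier_matI) (simp_all add: mat_of_rows_list_def)
  then show ?thesis
    by (subst det_3) (simp_all add: mat_of_rows_list_def)
qed

text \<open>With \<open>X\<close> the incidence matrix of positions and classes, the matrix on the
  left is \<open>D - X * Y\<close>, a perturbation of a diagonal matrix by rank at most
  \<open>m\<close>. The factor \<open>1 - Y * E * X\<close> left by the Sylvester identity has
  denominators \<open>d r\<close>; the product of all \<open>d r\<close> clears them, so the
  identity is free of division.\<close>

lemma det_constant_on_classes: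
  fixes d :: "nat \<Rightarrow> 'a :: field" and B :: "nat \<Rightarrow> nat \<Rightarrow> 'a" and cl :: "nat \<Rightarrow> nat"
  assumes cl: "\<And>i. i < n \<Longrightarrow> cl i < m" and d: "\<And>r. r < m \<Longrightarrow> d r \<noteq> 0"
  shows "det (mat n n (\<lambda>(i, j). (if i = j then d (cl i) else 0) - B (cl i) (cl j))) * (\<Prod>r<m. d r) =
    (\<Prod>r<m. d r ^ card {i. i < n \<and> cl i = r}) *
    det (mat m m (\<lambda>(r, s). (if r = s then d s else 0) - of_nat (card {i. i < n \<and> cl i = s}) * B r s))"
    (is "det ?L * _ = _ * det ?Q")
proof -
  define D where "D = mat_diag n (\<lambda>i. d (cl i))"
  define E where "E = mat_diag n (\<lambda>i. inverse (d (cl i)))"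
  define F where "F = mat_diag m d"
  define X where "X = mat n m (\<lambda>(i, r). of_bool (cl i = r) :: 'a)"
  define Y where "Y = mat m n (\<lambda>(r, j). B r (cl j))"
  have carr: "D \<in> carrier_mat n n" "E \<in> carrier_mat n n" "F \<in> carrier_mat m m"
    "X \<in> carrier_mat n m" "Y \<in> carrier_mat m n"
    by (auto simp: D_def E_def F_def X_def Y_def)
  have XY: "D - X * Y = ?L"
    by (rule eq_matI)
      (auto simp: D_def X_def Y_def mat_diag_def scalar_prod_def of_bool_def if_distrib[of "\<lambda>x. x * _"] cl
         cong: if_cong)
  have DE: "D * E = 1\<^sub>m n"
    unfolding D_def E_def mat_diag_diag by (rule eq_matI) (auto simp: mat_diag_def cl d)
  have EX: "E * X = mat n m (\<lambda>(i, r). of_bool (cl i = r) / d r)"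
    unfolding E_def X_def by (subst mat_diag_mult_left[of _ n m]) (auto intro!: eq_matI simp: field_simps)
  \<comment> \<open>Multiplying by \<open>F\<close> on the right scales column \<open>s\<close> by
    \<open>d s\<close>, which cancels the denominator that \<open>E\<close>, the inverse of
    \<open>D\<close>, left there. The class size arises from summing over the positions of class
    \<open>s\<close>.\<close>
  have YEXF: "(1\<^sub>m m - Y * (E * X)) * F = ?Q"
  proof -
    have "(\<Sum>i = 0..<n. B r (cl i) * (of_bool (cl i = s) / d s)) =
        of_nat (card {i. i < n \<and> cl i = s}) * B r s / d s" for r s
    proof -
      have "(\<Sum>i = 0..<n. B r (cl i) * (of_bool (cl i = s) / d s)) =
          (\<Sum>i\<in>{i. i < n \<and> cl i = s}. B r s / d s)"
        by (rule sum.mono_neutral_cong_right) auto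
      then show ?thesis by simp
    qed
    then show ?thesis
      unfolding F_def EX
      by (subst mat_diag_mult_right[of _ m m])
        (auto intro!: eq_matI simp: Y_def scalar_prod_def d algebra_simps)
  qed
  \<comment> \<open>\<open>?M\<close> is triangularised from the right in two ways, giving the two sides of the identity.\<close>
  let ?M = "four_block_mat D X Y (1\<^sub>m m)"
  let ?U = "four_block_mat (1\<^sub>m n) (0\<^sub>m n m) (- Y) (1\<^sub>m m)"
  let ?V = "four_block_mat (1\<^sub>m n) (- (E * X)) (0\<^sub>m m n) (1\<^sub>m m)"
  have M: "?M \<in> carrier_mat (n + m) (n + m)" and U: "?U \<in> carrier_mat (n + m) (n + m)"
    and V: "?V \<in> carrier_mat (n + m) (n + m)" using carr by auto
  have "?M * ?U = four_block_mat (D * 1\<^sub>m n + X * (- Y)) (D * 0\<^sub>m n m + X * 1\<^sub>m m)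
      (Y * 1\<^sub>m n + 1\<^sub>m m * (- Y)) (Y * 0\<^sub>m n m + 1\<^sub>m m * 1\<^sub>m m)"
    by (rule mult_four_block_mat) (use carr in auto)
  also have "\<dots> = four_block_mat (D - X * Y) X (0\<^sub>m m n) (1\<^sub>m m)"
    using carr by (intro arg_cong4[where f = four_block_mat]) (auto simp: add_uminus_minus_mat[symmetric] intro!: eq_matI)
  finally have "det (?M * ?U) = det ?L"
    using carr by (simp add: XY det_four_block_mat_lower_left_zero[of _ n _ m])
  moreover have "det ?U = 1"
    using carr by (simp add: det_four_block_mat_upper_right_zero[of _ n _ m])
  ultimately have 1: "det ?M = det ?L" using det_mult[OF M U] by simp
  have EXc: "E * X \<in> carrier_mat n m" using carr by auto
  have D_EX: "D * (E * X) = X"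
    using carr DE assoc_mult_mat[of D n n E n X m] by simp
  have "?M * ?V = four_block_mat (D * 1\<^sub>m n + X * 0\<^sub>m m n) (D * (- (E * X)) + X * 1\<^sub>m m)
      (Y * 1\<^sub>m n + 1\<^sub>m m * 0\<^sub>m m n) (Y * (- (E * X)) + 1\<^sub>m m * 1\<^sub>m m)"
    by (rule mult_four_block_mat) (use carr EXc in auto)
  also have "\<dots> = four_block_mat D (0\<^sub>m n m) Y (1\<^sub>m m - Y * (E * X))"
    using carr EXc D_EX by (intro arg_cong4[where f = four_block_mat]) (auto intro!: eq_matI)
  finally have "det (?M * ?V) = det (four_block_mat D (0\<^sub>m n m) Y (1\<^sub>m m - Y * (E * X)))" by simp
  also have "\<dots> = det D * det (1\<^sub>m m - Y * (E * X))"
    by (rule det_four_block_mat_upper_right_zero[OF carr(1) refl carr(5)])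
      (use carr EXc in \<open>auto intro!: minus_carrier_mat\<close>)
  finally have "det (?M * ?V) = det D * det (1\<^sub>m m - Y * (E * X))" .
  moreover have "det ?V = 1"
    using carr by (simp add: det_four_block_mat_lower_left_zero[of _ n _ m])
  ultimately have 2: "det ?M = det D * det (1\<^sub>m m - Y * (E * X))" using det_mult[OF M V] by simp
  have L: "det ?L = det D * det (1\<^sub>m m - Y * (E * X))" using 1 2 by (rule trans[OF sym])
  have Q: "det (1\<^sub>m m - Y * (E * X)) * det F = det ?Q"
    unfolding YEXF[symmetric] by (rule det_mult[symmetric]) (use carr in auto)
  have F: "det F = (\<Prod>r<m. d r)" and D: "det D = (\<Prod>i<n. d (cl i))"
    unfolding F_def D_def
    by (subst det_upper_triangular;
        auto simp: mat_diag_def upper_triangular_def diag_mat_def prod.list_conv_set_nth atLeast0LessThan)+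
  note D
  also have "(\<Prod>i<n. d (cl i)) = (\<Prod>r<m. d r ^ card {i. i < n \<and> cl i = r})"
    using cl by (subst prod.group[of "{..<n}" "{..<m}" cl, symmetric]) auto
  finally have D: "det D = (\<Prod>r<m. d r ^ card {i. i < n \<and> cl i = r})" .
  show ?thesis unfolding F[symmetric] D[symmetric] L Q[symmetric] by (rule mult.assoc)
qed

section \<open>Real roots of the cubic\<close>

text \<open>The polynomial takes the values \<open>- e1 * (v - u)\<close> at \<open>u\<close> and
  \<open>e2 * (v - u)\<close> at \<open>v\<close>, and its leading coefficient is -1. For positive
  \<open>e1\<close> and \<open>e2\<close> its signs along the real line are therefore +, -, +, -,
  which gives three roots separated by \<open>u\<close> and \<open>v\<close>. If both vanish, it is
  a product of linear factors; this covers \<alpha> = 1.\<close>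

lemma size_proots_perturbed_cubic:
  fixes d u v e1 e2 :: real
  assumes "u < v" and e: "e1 > 0 \<and> e2 > 0 \<or> e1 = 0 \<and> e2 = 0"
  shows "size (proots ([:d, - 1:] * ([:u, - 1:] * [:v, - 1:]) - smult e1 [:v, - 1:] - smult e2 [:u, - 1:])) = 3"
    (is "size (proots ?f) = 3")
proof -
  have f0: "?f \<noteq> 0" and deg: "degree ?f = 3" by (simp_all add: eval_nat_numeral)
  have val: "poly ?f x = (d - x) * ((u - x) * (v - x)) - e1 * (v - x) - e2 * (u - x)" for x
    by (simp add: algebra_simps)
  show ?thesis
  proof (cases "e1 = 0")
    case True
    with e have "e2 = 0" by auto
    with True have "?f = - ([:- d, 1:] * ([:- u, 1:] * [:- v, 1:]))" by (simp add: algebra_simps)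
    moreover have "[:c, 1:] \<noteq> (0 :: real poly)" for c by simp
    ultimately show ?thesis
      by (simp only: proots_uminus proots_mult mult_eq_0_iff simp_thms proots_linear_factor) simp
  next
    case False
    with e have e: "e1 > 0" "e2 > 0" by auto
    \<comment> \<open>\<open>M\<close> is at least 1 and so large that \<open>u - M\<close> and
      \<open>v + M\<close> lie at distance at least \<open>e1 + e2 + 1\<close> from
      \<open>d\<close>; there the cubic product dominates the linear terms.\<close>
    define M where "M = 1 + \<bar>d - u\<bar> + \<bar>d - v\<bar> + e1 + e2"
    have M: "M > 0" using e by (simp add: M_def)
    have w: "v - u + M > 0" using M \<open>u < v\<close> by simp
    \<comment> \<open>Here \<open>t\<close> is the distance from \<open>d\<close>. At both outer
      points the other two factors have absolute values \<open>M\<close> and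
      \<open>v - u + M\<close>.\<close>
    have dom: "t * (M * (v - u + M)) > e1 * (v - u + M) + e2 * (v - u + M)" if "t \<ge> e1 + e2 + 1" for t
    proof -
      have M1: "M \<ge> 1" using e by (simp add: M_def)
      have "e1 * (v - u + M) + e2 * (v - u + M) < t * (v - u + M)"
        unfolding distrib_right[symmetric] using that w by (intro mult_strict_right_mono) auto
      also have "\<dots> \<le> t * (M * (v - u + M))"
        using that e w M1 by (intro mult_left_mono) (auto simp: mult_le_cancel_right1)
      finally show ?thesis .
    qed
    have le: "e1 * M \<le> e1 * (v - u + M)" "e2 * M \<le> e2 * (v - u + M)" using e \<open>u < v\<close> by auto
    have "d - u + M \<ge> e1 + e2 + 1" "v + M - d \<ge> e1 + e2 + 1" by (simp_all add: M_def)
    note dom = this[THEN dom]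
    have "poly ?f (u - M) = (d - u + M) * (M * (v - u + M)) - e1 * (v - u + M) - e2 * M"
      by (simp only: val) (simp add: algebra_simps)
    then have "poly ?f (u - M) > 0" using dom(1) le by linarith
    moreover have u: "poly ?f u < 0" using e \<open>u < v\<close> by (simp only: val) simp
    moreover have v: "poly ?f v > 0" using e \<open>u < v\<close> by (simp only: val) (simp add: mult_less_0_iff)
    moreover have "poly ?f (v + M) < 0"
    proof -
      have "poly ?f (v + M) = e1 * M + e2 * (v - u + M) - (v + M - d) * (M * (v - u + M))"
        by (simp only: val) (simp add: algebra_simps)
      then show ?thesis using dom(2) le by linarith
    qed
    ultimately obtain r0 r1 r2 where r: "u - M < r0" "r0 < u" "poly ?f r0 = 0"
        "u < r1" "r1 < v" "poly ?f r1 = 0" "v < r2" "poly ?f r2 = 0"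
      using poly_IVT_neg[of "u - M" u ?f] poly_IVT_pos[of u v ?f] poly_IVT_neg[of v "v + M" ?f]
        M \<open>u < v\<close> by auto
    \<comment> \<open>The roots lie in disjoint intervals, so they are three distinct elements of
      the multiset; the degree bounds its size from above.\<close>
    have "{r0, r1, r2} \<subseteq> set_mset (proots ?f)"
      using r unfolding set_count_proots[OF f0] by blast
    then have "card {r0, r1, r2} \<le> card (set_mset (proots ?f))"
      by (rule card_mono[OF finite_set_mset])
    also have "\<dots> \<le> size (proots ?f)"
      using size_mset_mono[OF mset_set_set_mset_msubset] by (simp only: size_mset_set)
    finally have "3 \<le> size (proots ?f)" using r by simp
    then show ?thesis using size_proots_le[of ?f] deg by simp
  qed
qed

section \<open>Element orders in the dihedral group and the class structure of the matrix\<close>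

text \<open>Class 0 is the identity, class 1 the other rotations, class 2 the reflections. The diagonal
  entry of \<open>A\<^sub>\<alpha>\<close> at a vertex of class \<open>r\<close> is \<open>class_diag q \<alpha> r + class_entry q \<alpha> r r\<close>.\<close>

definition class_diag :: "real \<Rightarrow> real \<Rightarrow> nat \<Rightarrow> real" where
  "class_diag q \<alpha> r = (if r = 0 then 0 else if r = 1 then q * \<alpha> - 1 else (q + 1) * \<alpha> - 1)"

definition class_entry :: "real \<Rightarrow> real \<Rightarrow> nat \<Rightarrow> nat \<Rightarrow> real" where
  "class_entry q \<alpha> r s =
     (if r = 0 \<and> s = 0 then (2 * q - 1) * \<alpha> else if r = 0 \<or> s = 0 \<or> r = s then 1 - \<alpha> else 0)"

lemma out_degree_superpower_graph:
  "out_degree (with_proj (superpower_graph G)) x = card {y. (x, y) \<in> parcs (superpower_graph G)}"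
proof -
  have "out_arcs (with_proj (superpower_graph G)) x = Pair x ` {y. (x, y) \<in> parcs (superpower_graph G)}"
    by (auto simp: out_arcs_def)
  then show ?thesis by (simp add: out_degree_def card_image inj_on_def)
qed

context dihedral_group
begin

text \<open>\<open>R\<close> consists of the powers of \<open>a\<close>. Odd \<open>n\<close> keeps
  \<open>b\<close>, of order 2, out of \<open>R\<close>, so the coset of \<open>b\<close> is
  disjoint from \<open>R\<close> and, by counting, is the whole complement. Its elements square to
  the identity because \<open>b\<close> inverts the powers of \<open>a\<close> under
  conjugation.\<close>

lemma ord_dihedral:
  assumes n: "odd n"
  obtains R where "R \<subseteq> carrier G" "\<one> \<in> R" "finite R" "card R = n" "card (carrier G - R) = n"
    "\<And>x. x \<in> R \<Longrightarrow> ord x dvd n" "\<And>x. x \<in> carrier G - R \<Longrightarrow> ord x = 2"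
proof -
  let ?R = "{a [^] i | i. i \<in> {0 .. ord a - 1}}"
  have n0: "n > 0" using n by (auto intro: gr0I)
  \<comment> \<open>\<open>card\<close> is 0 on infinite sets, so a positive order forces
    finiteness.\<close>
  have fin: "finite (carrier G)"
    using order_G n0 card.infinite unfolding Coset.order_def by fastforce
  have R_closed: "?R \<subseteq> carrier G" using a_closed by auto
  have pow_in_R: "a [^] i \<in> ?R" for i :: nat
    using ord_elems[OF fin a_closed] by auto
  have card_R: "card ?R = n"
  proof -
    have "?R = (\<lambda>i. a [^] i) ` {0 .. ord a - 1}" by auto
    then show ?thesis using card_image[OF ord_inj[OF a_closed]] ord_a n0 by simp
  qed
  have ord_R: "ord x dvd n" if "x \<in> ?R" for x
  proof -
    obtain i where x: "x = a [^] (i :: nat)" using \<open>x \<in> ?R\<close> by auto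
    have "x [^] n = (a [^] n) [^] i"
      using a_closed by (simp add: x nat_pow_pow mult.commute)
    also have "\<dots> = \<one>" using pow_ord_eq_1[OF a_closed] by (simp add: ord_a)
    finally show ?thesis using a_closed x by (simp add: pow_eq_id)
  qed
  have b_notin: "b \<notin> ?R" using ord_R[of b] ord_b n by auto
  have inj: "inj_on (\<lambda>x. x \<otimes> b) ?R"
    using R_closed b_closed by (intro inj_onI) (metis (no_types, lifting) right_cancel subsetD)
  have shift: "x \<otimes> b \<notin> ?R" if "x \<in> ?R" for x
  proof
    assume "x \<otimes> b \<in> ?R"
    obtain i where x: "x = a [^] (i :: nat)" using \<open>x \<in> ?R\<close> by auto
    obtain j where xb: "x \<otimes> b = a [^] (j :: nat)" using \<open>x \<otimes> b \<in> ?R\<close> by auto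
    have xc: "x \<in> carrier G" using x a_closed by auto
    \<comment> \<open>With the inverse written as a natural power, \<open>b\<close> itself becomes a
      natural power of \<open>a\<close>, which is the contradiction.\<close>
    have "inv x = x [^] (n - 1)"
    proof (rule inv_equality)
      have "x [^] (n - 1) \<otimes> x = x [^] n" 
        using n0 xc by (cases n) (auto simp: nat_pow_Suc)
      also have "\<dots> = \<one>" using ord_R[OF \<open>x \<in> ?R\<close>] xc by (simp add: pow_eq_id)
      finally show "x [^] (n - 1) \<otimes> x = \<one>" .
    qed (use xc in auto)
    then have "b = x [^] (n - 1) \<otimes> a [^] j"
      using xb xc b_closed by (metis inv_solve_left m_closed)
    also have "\<dots> = a [^] (i * (n - 1) + j)"
      using a_closed by (simp add: x nat_pow_pow nat_pow_mult)
    finally show False using b_notin pow_in_R by auto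
  qed
  have compl_card: "card (carrier G - ?R) = n"
    using R_closed card_R order_G fin
    by (subst card_Diff_subset) (auto simp: Coset.order_def intro: finite_subset)
  have compl: "carrier G - ?R = (\<lambda>x. x \<otimes> b) ` ?R"
  proof (rule sym, rule card_subset_eq)
    show "(\<lambda>x. x \<otimes> b) ` ?R \<subseteq> carrier G - ?R" using shift R_closed b_closed by auto
    show "card ((\<lambda>x. x \<otimes> b) ` ?R) = card (carrier G - ?R)"
      using card_image[OF inj] card_R compl_card by simp
  qed (use fin in auto)
  have bpow: "b \<otimes> a [^] i = inv (a [^] i) \<otimes> b" for i :: nat
  proof (induction i)
    case (Suc i)
    have "b \<otimes> a [^] Suc i = (b \<otimes> a [^] i) \<otimes> a"
      using a_closed b_closed by (simp add: m_assoc)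
    also have "\<dots> = inv (a [^] i) \<otimes> (b \<otimes> a)"
      using a_closed b_closed by (simp add: Suc m_assoc)
    also have "\<dots> = (inv (a [^] i) \<otimes> inv a) \<otimes> b"
      using a_closed b_closed by (simp add: ba m_assoc)
    also have "inv (a [^] i) \<otimes> inv a = inv (a [^] Suc i)"
      using a_closed by (subst nat_pow_Suc2) (auto simp: inv_mult_group)
    finally show ?case .
  qed (use b_closed in auto)
  have ord_compl: "ord x = 2" if x_in: "x \<in> carrier G - ?R" for x
  proof -
    obtain i where x: "x = a [^] (i :: nat) \<otimes> b"
      using x_in unfolding compl by auto
    have "x \<otimes> x = a [^] i \<otimes> (b \<otimes> a [^] i) \<otimes> b"
      using a_closed b_closed by (simp add: x m_assoc)
    also have "\<dots> = (a [^] i \<otimes> inv (a [^] i)) \<otimes> (b \<otimes> b)"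
      using a_closed b_closed unfolding bpow by (simp add: m_assoc del: r_inv Units_r_inv)
    also have "b \<otimes> b = \<one>" using pow_ord_eq_1[OF b_closed] b_closed by (simp add: ord_b numeral_2_eq_2)
    finally have "x \<otimes> x = \<one>" using a_closed by simp
    then have "x [^] (2 :: nat) = \<one>" using that by (simp add: numeral_2_eq_2)
    then have "ord x dvd 2" using that by (simp add: pow_eq_id)
    moreover have "x \<noteq> \<one>" using that pow_in_R[of 0] by auto
    then have "ord x \<noteq> 1" using that ord_eq_1 by auto
    ultimately show ?thesis by (metis two_is_prime_nat prime_nat_iff)
  qed
  show ?thesis
  proof (rule that[OF R_closed _ finite_subset[OF R_closed fin] card_R compl_card ord_R ord_compl])
    show "\<one> \<in> ?R" using pow_in_R[of 0] by simp
  qed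
qed

text \<open>This separates the group theory from the linear algebra: afterwards only the class sizes
  and the entries per pair of classes matter. Primality of \<open>p\<close> makes all divisors of
  \<open>p ^ k\<close> powers of \<open>p\<close>, hence pairwise comparable under
  divisibility.\<close>

lemma A_alpha_superpower_dihedral:
  assumes p: "prime p" "odd p" and n: "n = p ^ k"
    and vs: "distinct vs" "set vs = carrier G"
  obtains cl :: "'a \<Rightarrow> nat" where "\<And>x. cl x < 3"
    "card {x \<in> carrier G. cl x = 0} = 1" "card {x \<in> carrier G. cl x = 1} = n - 1"
    "card {x \<in> carrier G. cl x = 2} = n"
    "A_alpha_matrix \<alpha> (superpower_graph G) vs =
      mat (length vs) (length vs) (\<lambda>(i, j). (if i = j then class_diag n \<alpha> (cl (vs ! i)) else 0)
        + class_entry n \<alpha> (cl (vs ! i)) (cl (vs ! j)))"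
proof -
  have odd: "odd n" using p n by simp
  then have n0: "n > 0" by (auto intro: gr0I)
  obtain R where R: "R \<subseteq> carrier G" "\<one> \<in> R" "finite R" "card R = n" "card (carrier G - R) = n"
    "\<And>x. x \<in> R \<Longrightarrow> ord x dvd n" "\<And>x. x \<in> carrier G - R \<Longrightarrow> ord x = 2"
    using ord_dihedral[OF odd] by blast
  have fin: "finite (carrier G)" "finite (carrier G - R)"
    using R n0 card.infinite finite_Diff2 by fastforce+
  have card_G: "card (carrier G) = 2 * n" using order_G by (simp add: Coset.order_def)
  have arcs: "(x, y) \<in> parcs (superpower_graph G) \<longleftrightarrow>
      x \<in> carrier G \<and> y \<in> carrier G \<and> x \<noteq> y \<and> (x = \<one> \<or> y = \<one> \<or> (x \<in> R \<longleftrightarrow> y \<in> R))" for x y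
  proof -
    have RR: "ord x dvd ord y \<or> ord y dvd ord x" if xy: "x \<in> R" "y \<in> R" for x y
    proof -
      obtain i j where "ord x = p ^ i" "ord y = p ^ j"
        using R(6)[OF xy(1)] R(6)[OF xy(2)] p(1) by (auto simp: n divides_primepow_nat)
      then show ?thesis using le_imp_power_dvd nat_le_linear by metis
    qed
    \<comment> \<open>An odd order other than 1 and the order 2 do not divide one another.\<close>
    have RS: "\<not> (ord x dvd ord y \<or> ord y dvd ord x)" if "x \<in> R" "y \<in> carrier G" "y \<notin> R" "x \<noteq> \<one>" for x y
    proof -
      have "odd (ord x)" using R(6)[OF that(1)] odd dvd_trans by blast
      moreover have "ord x \<noteq> 1" using that R(1) ord_eq_1 by auto
      moreover have "ord y = 2" using R(7) that by auto
      ultimately show ?thesis by (metis prime_nat_iff two_is_prime_nat dvd_refl)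
    qed
    have SS: "ord x dvd ord y" if "x \<in> carrier G - R" "y \<in> carrier G - R" for x y
      using that R(7) by simp
    show ?thesis
      using RR[of x y] RS[of x y] RS[of y x] SS[of x y] R(2)
      by (auto simp: superpower_graph_def)
  qed
  define cl :: "'a \<Rightarrow> nat" where "cl x = (if x = \<one> then 0 else if x \<in> R then 1 else 2)" for x
  \<comment> \<open>A nontrivial rotation is joined to the rest of \<open>R\<close>, which contains
    the identity. A reflection loses itself from its coset but gains the identity, whence
    \<open>n\<close> and not \<open>n - 1\<close>.\<close>
  have deg: "real (out_degree (with_proj (superpower_graph G)) x) =
      (if cl x = 0 then 2 * n - 1 else if cl x = 1 then n - 1 else n)" if "x \<in> carrier G" for x
  proof -
    have "{y. (x, y) \<in> parcs (superpower_graph G)} =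
        (if x = \<one> then carrier G - {\<one>} else if x \<in> R then R - {x} else insert \<one> (carrier G - R - {x}))"
      using that R(1,2) by (auto simp: arcs)
    then show ?thesis
      using that R fin card_G n0
      by (auto simp: out_degree_superpower_graph cl_def card_insert_if card_Diff_singleton_if of_nat_diff)
  qed
  show ?thesis
  proof (rule that[of cl])
    show "cl x < 3" for x by (simp add: cl_def)
    have "{x \<in> carrier G. cl x = 0} = {\<one>}" "{x \<in> carrier G. cl x = 1} = R - {\<one>}"
      "{x \<in> carrier G. cl x = 2} = carrier G - R"
      using R(1,2) by (auto simp: cl_def split: if_splits)
    then show "card {x \<in> carrier G. cl x = 0} = 1" "card {x \<in> carrier G. cl x = 1} = n - 1"
      "card {x \<in> carrier G. cl x = 2} = n"
      using R by (simp_all add: card_Diff_singleton_if)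
  next
    have vsc: "vs ! i \<in> carrier G" if "i < length vs" for i
      using nth_mem[OF that] vs(2) by blast
    have n_real: "real (2 * n - 1) = 2 * real n - 1" "real (n - 1) = real n - 1"
      using n0 by (simp_all add: of_nat_diff)
    show "A_alpha_matrix \<alpha> (superpower_graph G) vs =
        mat (length vs) (length vs) (\<lambda>(i, j). (if i = j then class_diag n \<alpha> (cl (vs ! i)) else 0)
          + class_entry n \<alpha> (cl (vs ! i)) (cl (vs ! j)))" (is "_ = ?M")
    proof (rule eq_matI)
      fix i j
      assume "i < dim_row ?M" "j < dim_col ?M"
      then have ij: "i < length vs" "j < length vs" by auto
      have eq: "vs ! i = vs ! j \<longleftrightarrow> i = j" by (rule nth_eq_iff_index_eq[OF vs(1) ij])
      have "A_alpha_matrix \<alpha> (superpower_graph G) vs $$ (i, j) =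
          (if i = j then \<alpha> * real (out_degree (with_proj (superpower_graph G)) (vs ! i)) else 0)
          + (if (vs ! i, vs ! j) \<in> parcs (superpower_graph G) then 1 - \<alpha> else 0)"
        using ij by (simp add: A_alpha_matrix_def degree_matrix_def adjacency_matrix_def mat_diag_def)
      also have "\<dots> = (if i = j then class_diag n \<alpha> (cl (vs ! i)) else 0)
          + class_entry n \<alpha> (cl (vs ! i)) (cl (vs ! j))"
      proof (cases "i = j")
        case True
        then show ?thesis
          using n_real by (simp add: arcs deg[OF vsc] ij class_diag_def class_entry_def cl_def algebra_simps)
      next
        case False
        then show ?thesis
          using vsc[OF ij(1)] vsc[OF ij(2)] R(2) eq
          by (auto simp: arcs class_entry_def cl_def)
      qed
      finally show "A_alpha_matrix \<alpha> (superpower_graph G) vs $$ (i, j) = ?M $$ (i, j)"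
        using ij by simp
    qed (auto simp: A_alpha_matrix_def degree_matrix_def adjacency_matrix_def)
  qed
qed

end

section \<open>Factoring the characteristic polynomial and reading off the spectrum\<close>

theorem theorem4p1:
  fixes G :: "('a, 'b) monoid_scheme" and a b :: 'a and p k :: nat and \<alpha> :: real
    and vs :: "'a list"
  assumes "prime p" and "odd p" and "k \<ge> 1"
    and "0 \<le> \<alpha>" and "\<alpha> \<le> 1"
    and "dihedral_group G (p ^ k) a b"
    and "distinct vs" and "set vs = carrier G"
  shows "let q = real (p ^ k);
             spec = spectrum_mset (A_alpha_matrix \<alpha> (superpower_graph G) vs);
             cubic = det (mat_of_rows_list 3
               [[ [:(2 * q - 1) * \<alpha>, - 1:], [:(q - 1) * (1 - \<alpha>):],  [:q * (1 - \<alpha>):]     ],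
                [ [:1 - \<alpha>:],              [:q + \<alpha> - 2, - 1:],     0                    ],
                [ [:1 - \<alpha>:],              0,                       [:q + \<alpha> - 1, - 1:]  ]])
         in size spec = 2 * p ^ k
          \<and> size (proots cubic) = 3
          \<and> spec = replicate_mset (p ^ k - 1) ((q + 1) * \<alpha> - 1)
                 + replicate_mset (p ^ k - 2) (q * \<alpha> - 1)
                 + proots cubic"
proof -
  interpret dihedral_group G "p ^ k" a b by fact
  define n where "n = p ^ k"
  define q where "q = real n"
  define \<delta>1 where "\<delta>1 = q * \<alpha> - 1"
  define \<delta>2 where "\<delta>2 = (q + 1) * \<alpha> - 1"
  define A where "A = A_alpha_matrix \<alpha> (superpower_graph G) vs"
  define cubic where "cubic = det (mat_of_rows_list 3
      [[ [:(2 * q - 1) * \<alpha>, - 1:], [:(q - 1) * (1 - \<alpha>):],  [:q * (1 - \<alpha>):] ],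
       [ [:1 - \<alpha>:], [:q + \<alpha> - 2, - 1:], 0 ],
       [ [:1 - \<alpha>:], 0, [:q + \<alpha> - 1, - 1:] ]])"
  have "p \<noteq> 2" using \<open>odd p\<close> by auto
  then have "p \<ge> 3" using prime_ge_2_nat[OF \<open>prime p\<close>] by linarith
  \<comment> \<open>This bound makes the truncated differences \<open>n - 1\<close> and
    \<open>n - 2\<close> exact.\<close>
  then have n3: "n \<ge> 3" using self_le_power[of p k] \<open>k \<ge> 1\<close> by (simp add: n_def)
  have q3: "q \<ge> 3" using n3 by (simp add: q_def)
  have cubic_eq: "cubic = [:(2 * q - 1) * \<alpha>, - 1:] * ([:q + \<alpha> - 2, - 1:] * [:q + \<alpha> - 1, - 1:])
      - smult ((q - 1) * (1 - \<alpha>)\<^sup>2) [:q + \<alpha> - 1, - 1:] - smult (q * (1 - \<alpha>)\<^sup>2) [:q + \<alpha> - 2, - 1:]"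
    unfolding cubic_def det_mat_of_rows_list_3
    by (rule poly_ext, simp only: poly_add poly_diff poly_mult poly_smult poly_pCons poly_0
        mult_zero_right mult_zero_left add_0_right diff_zero diff_0)
      (simp add: power2_eq_square algebra_simps)
  \<comment> \<open>The two perturbation coefficients are \<open>q - 1\<close> and \<open>q\<close>
    times the square of 1 - \<alpha>: both are positive unless \<alpha> = 1, where both
    vanish.\<close>
  have size_cubic: "size (proots cubic) = 3"
    unfolding cubic_eq by (rule size_proots_perturbed_cubic) (use q3 in \<open>auto\<close>)
  \<comment> \<open>\<open>proots 0\<close> is empty by convention, so size 3 excludes the zero
    polynomial.\<close>
  then have cubic0: "cubic \<noteq> 0" by auto
  obtain cl where cl: "\<And>x. cl x < 3" "card {x \<in> carrier G. cl x = 0} = 1"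
    "card {x \<in> carrier G. cl x = 1} = n - 1" "card {x \<in> carrier G. cl x = 2} = n"
    and "A_alpha_matrix \<alpha> (superpower_graph G) vs =
      mat (length vs) (length vs) (\<lambda>(i, j). (if i = j then class_diag n \<alpha> (cl (vs ! i)) else 0)
        + class_entry n \<alpha> (cl (vs ! i)) (cl (vs ! j)))"
    by (rule A_alpha_superpower_dihedral[OF assms(1,2) refl assms(7,8), of \<alpha>, folded n_def]) (rule that; assumption)
  then have A: "A = mat (length vs) (length vs) (\<lambda>(i, j). (if i = j then class_diag q \<alpha> (cl (vs ! i)) else 0)
      + class_entry q \<alpha> (cl (vs ! i)) (cl (vs ! j)))"
    by (simp only: A_def q_def)
  have count: "card {i. i < length vs \<and> cl (vs ! i) = r} = card {x \<in> carrier G. cl x = r}" for r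
  proof -
    have "(!) vs ` {i. i < length vs \<and> cl (vs ! i) = r} = {x \<in> carrier G. cl x = r}"
      unfolding assms(8)[symmetric] by (auto simp: in_set_conv_nth)
    moreover have "inj_on ((!) vs) {i. i < length vs \<and> cl (vs ! i) = r}"
      by (rule inj_on_nth[OF assms(7)]) simp
    ultimately show ?thesis using card_image[of "(!) vs"] by fastforce
  qed
  \<comment> \<open>The sign appears because the characteristic polynomial is monic while
    \<open>cubic\<close> has leading coefficient -1. The point 0 is excluded because
    \<open>class_diag\<close> is 0 on the identity class, so that \<open>D 0\<close> is
    \<open>x\<close>, which has to be invertible.\<close>
  have off_roots: "poly (char_poly A) x = poly (- ([:- \<delta>1, 1:] ^ (n - 2) * [:- \<delta>2, 1:] ^ (n - 1) * cubic)) x"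
    if x: "x \<notin> {0, \<delta>1, \<delta>2}" for x
  proof -
    define D where "D r = x - class_diag q \<alpha> r" for r
    have lessThan_3: "{..<3 :: nat} = {0, 1, 2}" by auto
    have D: "D 0 = x" "D 1 = x - \<delta>1" "D 2 = x - \<delta>2" "D (Suc 0) = x - \<delta>1"
      by (auto simp: D_def class_diag_def \<delta>1_def \<delta>2_def)
    have "r < 3 \<Longrightarrow> D r \<noteq> 0" for r
      using x by (auto simp: less_Suc_eq numeral_3_eq_3 D D(3)[unfolded numeral_2_eq_2])
    note det = det_constant_on_classes[of "length vs" "\<lambda>i. cl (vs ! i)" 3 D "class_entry q \<alpha>", OF cl(1) this]
    have "poly (char_poly A) x = det (- char_matrix A x)"
      by (rule char_poly_matrix[of A "length vs"]) (simp add: A)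
    also have "- char_matrix A x = mat (length vs) (length vs)
        (\<lambda>(i, j). (if i = j then D (cl (vs ! i)) else 0) - class_entry q \<alpha> (cl (vs ! i)) (cl (vs ! j)))"
      by (rule eq_matI) (auto simp: char_matrix_def A D_def)
    finally have "poly (char_poly A) x * (\<Prod>r<3. D r) = (\<Prod>r<3. D r ^ card {x \<in> carrier G. cl x = r}) *
        det (mat 3 3 (\<lambda>(r, s). (if r = s then D s else 0)
          - of_nat (card {x \<in> carrier G. cl x = s}) * class_entry q \<alpha> r s))"
      using det unfolding count by simp
    \<comment> \<open>\<open>?Q\<close> is \<open>x\<close> minus the quotient matrix, the negative
      of the matrix defining \<open>cubic\<close> at \<open>x\<close>; the odd order 3 turns this
      into a sign.\<close>
    also have "det (mat 3 3 (\<lambda>(r, s). (if r = s then D s else 0)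
        - of_nat (card {x \<in> carrier G. cl x = s}) * class_entry q \<alpha> r s)) = - poly cubic x"
      (is "det ?Q = _")
    proof -
      have n1: "real (n - Suc 0) = q - 1" using n3 by (simp add: q_def of_nat_diff)
      let ?d = "(2 * q - 1) * \<alpha> - x" and ?u = "q + \<alpha> - 2 - x" and ?v = "q + \<alpha> - 1 - x"
      have uv: "x - \<delta>1 - (q - 1) * (1 - \<alpha>) = - ?u" "x - \<delta>2 - q * (1 - \<alpha>) = - ?v"
        by (simp_all add: \<delta>1_def \<delta>2_def algebra_simps)
      have Q: "?Q = mat_of_rows_list 3
          [[- ?d, - ((q - 1) * (1 - \<alpha>)), - (q * (1 - \<alpha>))],
           [- (1 - \<alpha>), x - \<delta>1 - (q - 1) * (1 - \<alpha>), 0],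
           [- (1 - \<alpha>), 0, x - \<delta>2 - q * (1 - \<alpha>)]]"
        by (rule eq_matI)
          (auto simp: mat_of_rows_list_def less_Suc_eq numeral_3_eq_3 class_entry_def D D(3)[unfolded numeral_2_eq_2]
            cl(2-4)[simplified numeral_2_eq_2 One_nat_def] n1 q_def[symmetric])
      have "det ?Q = - (?d * (?u * ?v) - (q - 1) * (1 - \<alpha>)\<^sup>2 * ?v - q * (1 - \<alpha>)\<^sup>2 * ?u)"
        unfolding Q uv det_mat_of_rows_list_3 by (simp add: power2_eq_square algebra_simps)
      moreover have "poly cubic x = ?d * (?u * ?v) - (q - 1) * (1 - \<alpha>)\<^sup>2 * ?v - q * (1 - \<alpha>)\<^sup>2 * ?u"
        unfolding cubic_eq poly_diff poly_mult poly_smult poly_pCons by simp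
      ultimately show ?thesis by simp
    qed
    also have "(\<Prod>r<3. D r ^ card {x \<in> carrier G. cl x = r}) = x * (x - \<delta>1) ^ (n - 1) * (x - \<delta>2) ^ n"
      unfolding lessThan_3 by (simp add: D cl(2-4)[simplified])
    \<comment> \<open>Splitting off the product of the \<open>D r\<close> lowers the exponents 1,
      \<open>n - 1\<close>, \<open>n\<close> by one each, so the factor \<open>x\<close>
      disappears.\<close>
    also have "\<dots> = (x - \<delta>1) ^ (n - 2) * (x - \<delta>2) ^ (n - 1) * (\<Prod>r<3. D r)"
    proof -
      have "n - 1 = Suc (n - 2)" "n = Suc (n - 1)" using n3 by auto
      then have "(x - \<delta>1) ^ (n - 1) = (x - \<delta>1) * (x - \<delta>1) ^ (n - 2)"
        "(x - \<delta>2) ^ n = (x - \<delta>2) * (x - \<delta>2) ^ (n - 1)" by (metis power_Suc)+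
      then show ?thesis unfolding lessThan_3 by (simp add: D)
    qed
    finally have "poly (char_poly A) x * (\<Prod>r<3. D r) =
        (- ((x - \<delta>1) ^ (n - 2) * (x - \<delta>2) ^ (n - 1) * poly cubic x)) * (\<Prod>r<3. D r)" by simp
    moreover have "(\<Prod>r<3. D r) \<noteq> 0" using x unfolding lessThan_3 by (simp add: D)
    ultimately have "poly (char_poly A) x = - ((x - \<delta>1) ^ (n - 2) * (x - \<delta>2) ^ (n - 1) * poly cubic x)"
      using mult_right_cancel by blast
    then show ?thesis by simp
  qed
  \<comment> \<open>A nonzero difference would have only finitely many roots, yet it vanishes off
    three points.\<close>
  have char_poly: "char_poly A = - ([:- \<delta>1, 1:] ^ (n - 2) * [:- \<delta>2, 1:] ^ (n - 1) * cubic)" (is "_ = ?P")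
  proof (rule ccontr)
    assume "char_poly A \<noteq> ?P"
    then have "finite {x. poly (char_poly A - ?P) x = 0}" by (intro poly_roots_finite) simp
    moreover have "- {0, \<delta>1, \<delta>2} \<subseteq> {x. poly (char_poly A - ?P) x = 0}"
      unfolding poly_diff using off_roots by auto
    ultimately have "finite (- {0, \<delta>1, \<delta>2})" by (rule rev_finite_subset)
    then show False using infinite_UNIV_char_0[where 'a = real] by (simp only: finite_compl finite.intros)
  qed
  have lin: "[:c, 1:] ^ m \<noteq> (0 :: real poly)" for c m by simp
  have rep: "repeat_mset m {#y#} = replicate_mset m y" for m and y :: real
    by (induction m) auto
  \<comment> \<open>\<open>proots\<close> adds up over products, so coincidences among
    \<open>\<delta>1\<close>, \<open>\<delta>2\<close> and the roots of the cubic need no case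
    distinction.\<close>
  have "spectrum_mset A = replicate_mset (n - 1) \<delta>2 + replicate_mset (n - 2) \<delta>1 + proots cubic"
    unfolding spectrum_mset_def char_poly proots_uminus
    using cubic0 lin by (simp add: proots_mult proots_power rep)
  moreover from this have "size (spectrum_mset A) = 2 * n" using n3 by (simp add: size_cubic)
  ultimately show ?thesis
    using size_cubic unfolding Let_def A_def cubic_def q_def n_def \<delta>1_def \<delta>2_def by simp
qed

end
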